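(* Let $q$ be a prime power. If $\mathcal{C}$ is an $[n,k,d;r]_q$-locally repairable code, then: (i) there exists an $[n+1,k,d;r]_q$-locally repairable code; (ii) there exists an $[n-1,\ge k-1,d;r]_q$-locally repairable code; (iii) there exists an $[n-t,\ \ge k-t+s,\ \ge d-s;\ r]_q$-locally repairable code for any $0\le s\le t$, provided that $\mathcal{C}$ has disjoint recovery sets and one of the recovery sets has size $t$.
   Context: An $[n,k,d]_q$-linear code is a $k$-dimensional $\mathbb{F}_q$-subspace of $\mathbb{F}_q^n$ with minimum Hamming distance $d$. Writing $\ge k$ in place of $k$ means the dimension is at least $k$; writing $\ge d$ in place of $d$ means the minimum distance is at least $d$. A linear code $\mathcal{C}\subseteq\mathbb{F}_q^n$ has locality $r$ if for every $i\in[n]=\{1,\dots,n\}$ there is a set $R\subseteq[n]\setminus\{i\}$ with $|R|\le r$ such that for all $\mathbf{u},\mathbf{v}\in\mathcal{C}$: $\mathbf{u}_{R\cup\{i\}}=\mathbf{v}_{R\cup\{i\}}$ if and only if $\mathbf{u}_R=\mathbf{v}_R$; the set $R\cup\{i\}$ is called a recovery set of $i$. Equivalently, a set $R'\ni i$ is a recovery set of $i$ if and only if there is $\mathbf{c}$ in the dual code $\mathcal{C}^\perp$ with $i\in\mathrm{supp}(\mathbf{c})\subseteq R'$. An $[n,k,d;r]_q$-locally repairable code is an $[n,k,d]_q$-linear code with locality $r$ (similarly with $\ge$). "$\mathcal{C}$ has disjoint recovery sets" means that $[n]$ is a disjoint union of recovery sets, each of size at most $r+1$ and each being a recovery set of every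 coordinate in it.
   Formalization: In (iii) the formal statement also requires s < d (false otherwise: the [2,1,2;1] repetition code with s = t = 2); in (ii) it assumes n ≥ 1 and, when d = n, allows the zero code, since no nonzero code of length n-1 has distance n. *)

theory Defs
  imports "Jordan_Normal_Form.VS_Connect" "HOL-Library.Extended_Nat" "HOL-Library.Disjoint_Sets"
begin

text \<open>
  The field \<open>F_q\<close> is a type of class \<open>{field, finite}\<close>, so \<open>q\<close> is its cardinality.  A word of
  length \<open>n\<close> is a vector in \<open>carrier_vec n\<close>, whose coordinates are numbered from \<open>0\<close> to
  \<open>n - 1\<close> rather than from \<open>1\<close> to \<open>n\<close>.
\<close>

definition linear_code :: "nat \<Rightarrow> 'a::{field,finite} vec set \<Rightarrow> bool" where
  "linear_code n C \<longleftrightarrow> VectorSpace.subspace class_ring C (module_vec TYPE('a) n)"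

definition code_dim :: "nat \<Rightarrow> 'a::{field,finite} vec set \<Rightarrow> nat" where
  "code_dim n C = vectorspace.dim class_ring ((module_vec TYPE('a) n)\<lparr>carrier := C\<rparr>)"

definition hamming_dist :: "'a vec \<Rightarrow> 'a vec \<Rightarrow> nat" where
  "hamming_dist u v = card {i. i < dim_vec u \<and> u $ i \<noteq> v $ i}"

text \<open>The infimum over the empty set in \<^typ>\<open>enat\<close> is infinite, so the zero code, which has no
  two distinct codewords, has minimum distance \<open>\<infinity>\<close>.\<close>

definition min_dist :: "'a vec set \<Rightarrow> enat" where
  "min_dist C = Inf {enat (hamming_dist u v) |u v. u \<in> C \<and> v \<in> C \<and> u \<noteq> v}"

definition agree_on :: "nat set \<Rightarrow> 'a vec \<Rightarrow> 'a vec \<Rightarrow> bool" where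
  "agree_on A u v \<longleftrightarrow> (\<forall>j\<in>A. u $ j = v $ j)"

text \<open>The set \<open>A\<close> plays the role of \<open>R \<union> {i}\<close> with \<open>R = A - {i}\<close>.  No bound on its size is part
  of this notion; the bound is imposed where recovery sets are used.\<close>

definition recovery_set :: "nat \<Rightarrow> 'a vec set \<Rightarrow> nat \<Rightarrow> nat set \<Rightarrow> bool" where
  "recovery_set n C i A \<longleftrightarrow> A \<subseteq> {..<n} \<and> i \<in> A \<and>
     (\<forall>u\<in>C. \<forall>v\<in>C. agree_on A u v \<longleftrightarrow> agree_on (A - {i}) u v)"

definition has_locality :: "nat \<Rightarrow> 'a vec set \<Rightarrow> nat \<Rightarrow> bool" where
  "has_locality n C r \<longleftrightarrow>
     (\<forall>i<n. \<exists>R. R \<subseteq> {..<n} - {i} \<and> card R \<le> r \<and> recovery_set n C i (insert i R))"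

text \<open>The partition \<open>P\<close> witnesses that \<open>C\<close> has disjoint recovery sets.\<close>

definition disjoint_recovery_sets :: "nat \<Rightarrow> 'a vec set \<Rightarrow> nat \<Rightarrow> nat set set \<Rightarrow> bool" where
  "disjoint_recovery_sets n C r P \<longleftrightarrow> partition_on {..<n} P \<and>
     (\<forall>A\<in>P. card A \<le> r + 1 \<and> (\<forall>i\<in>A. recovery_set n C i A))"

end

theory Submission
  imports Defs "HOL-Library.Cardinality"
begin

text \<open>
  For (i) append a zero coordinate.  For (ii) shorten at a coordinate where a minimum weight codeword
  vanishes; if there is none, then \<open>d = n\<close> and shortening at any coordinate leaves the zero code.
  For (iii) shorten at \<open>t - s\<close> coordinates of the recovery set of size \<open>t\<close> and puncture the other
  \<open>s\<close>: puncturing is injective because \<open>s < d\<close>, and the remaining recovery sets are untouched.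
  Over a finite field dimensions can be read off from cardinalities, so that they are estimated by
  counting codewords.
\<close>

section \<open>Linear codes\<close>

lemma linear_code_iff:
  "linear_code n (C :: 'a::{field,finite} vec set) \<longleftrightarrow>
     C \<subseteq> carrier_vec n \<and> 0\<^sub>v n \<in> C \<and> (\<forall>u\<in>C. \<forall>v\<in>C. u + v \<in> C) \<and> (\<forall>a. \<forall>v\<in>C. a \<cdot>\<^sub>v v \<in> C)"
  using vec_vs[where 'a = 'a, of n] vec_module[where 'a = 'a, of n]
  by (auto simp: linear_code_def VectorSpace.subspace_def submodule_def module_vec_simps)

lemma linear_codeD:
  fixes C :: "'a::{field,finite} vec set"
  assumes "linear_code n C"
  shows "C \<subseteq> carrier_vec n" "0\<^sub>v n \<in> C"
    and "\<And>u v. u \<in> C \<Longrightarrow> v \<in> C \<Longrightarrow> u + v \<in> C"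
    and "\<And>a v. v \<in> C \<Longrightarrow> a \<cdot>\<^sub>v v \<in> C"
  using assms by (auto simp: linear_code_iff)

lemma linear_code_carrier:
  assumes "linear_code n C" "u \<in> C"
  shows "u \<in> carrier_vec n" "dim_vec u = n"
  using linear_codeD(1)[OF assms(1)] assms(2) by auto

lemma linear_code_diff:
  fixes C :: "'a::{field,finite} vec set"
  assumes "linear_code n C" "u \<in> C" "v \<in> C"
  shows "u - v \<in> C"
proof -
  have "u - v = u + (-1) \<cdot>\<^sub>v v"
    using linear_code_carrier[OF assms(1)] assms(2,3) by (intro eq_vecI) auto
  then show ?thesis
    using linear_codeD(3,4)[OF assms(1)] assms(2,3) by simp
qed

text \<open>Serves both \<open>append_zero\<close> and \<open>select_coords\<close>, which are
  linear maps between spaces of words of different lengths.\<close>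

lemma linear_code_image:
  fixes C :: "'a::{field,finite} vec set"
  assumes C: "linear_code n C"
    and T: "\<And>u. u \<in> carrier_vec n \<Longrightarrow> T u \<in> carrier_vec m"
    and add: "\<And>u v. u \<in> carrier_vec n \<Longrightarrow> v \<in> carrier_vec n \<Longrightarrow> T (u + v) = T u + T v"
    and smult: "\<And>a u. u \<in> carrier_vec n \<Longrightarrow> T (a \<cdot>\<^sub>v u) = a \<cdot>\<^sub>v T u"
  shows "linear_code m (T ` C)"
  unfolding linear_code_iff
proof (intro conjI ballI allI)
  note c = linear_code_carrier(1)[OF C]
  show "T ` C \<subseteq> carrier_vec m" using T c by auto
  \<comment> \<open>Homogeneity with the scalar 0 sends zero to zero; the length \<open>m\<close> of
    the image comes from \<open>T\<close>.\<close>
  have "T (0\<^sub>v n) = T (0 \<cdot>\<^sub>v 0\<^sub>v n)" by (intro arg_cong[of _ _ T] eq_vecI) auto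
  also have "\<dots> = 0 \<cdot>\<^sub>v T (0\<^sub>v n)" by (rule smult) simp
  also have "\<dots> = 0\<^sub>v m" using T[of "0\<^sub>v n"] by auto
  finally show "0\<^sub>v m \<in> T ` C" using linear_codeD(2)[OF C] by (metis imageI)
  show "x + y \<in> T ` C" if "x \<in> T ` C" "y \<in> T ` C" for x y
    using that add c linear_codeD(3)[OF C] by (auto simp flip: add)
  show "a \<cdot>\<^sub>v x \<in> T ` C" if "x \<in> T ` C" for a x
    using that smult c linear_codeD(4)[OF C] by (auto simp flip: smult)
qed

section \<open>Counting codewords and dimension\<close>

lemma finite_carrier_vec: "finite (carrier_vec n :: 'a::finite vec set)"
proof (rule finite_surj)
  show "finite {xs :: 'a list. set xs \<subseteq> UNIV \<and> length xs = n}"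
    by (rule finite_lists_length_eq) simp
  show "carrier_vec n \<subseteq> vec_of_list ` {xs :: 'a list. set xs \<subseteq> UNIV \<and> length xs = n}"
    by (auto intro!: image_eqI[of _ _ "list_of_vec _"] simp: vec_list)
qed

lemma finite_linear_code: "linear_code n C \<Longrightarrow> finite C"
  by (rule finite_subset[OF linear_codeD(1) finite_carrier_vec])

text \<open>With respect to a basis \<open>B\<close>, codewords correspond bijectively to
  coefficient functions on \<open>B\<close>, of which there are
  \<open>CARD('a) ^ card B\<close>.\<close>

lemma card_linear_code:
  fixes C :: "'a::{field,finite} vec set"
  assumes C: "linear_code n C"
  shows "card C = CARD('a) ^ code_dim n C"
proof -
  interpret V: vectorspace "class_ring :: 'a ring" "module_vec TYPE('a) n"
    by (rule vec_vs)
  let ?W = "(module_vec TYPE('a) n)\<lparr>carrier := C\<rparr>"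
  interpret W: vectorspace "class_ring :: 'a ring" ?W
    using C by (intro V.subspace_is_vs) (simp add: linear_code_def)
  \<comment> \<open>The finite set \<open>C\<close> spans itself, so the space is finite-dimensional
    and has a finite basis.\<close>
  have "W.span C = C"
    using W.in_own_span[of C] W.span_is_subset2[of C] by auto
  then have "W.fin_dim"
    using finite_linear_code[OF C] by (auto simp: W.fin_dim_def)
  then obtain B where B: "finite B" "W.basis B"
    using W.finite_basis_exists by blast
  then have BC: "B \<subseteq> carrier ?W" by (simp add: W.basis_def)
  \<comment> \<open>Extensional coefficient functions make the representation unique as a function
    and not only on \<open>B\<close>.\<close>
  have repr: "\<exists>!a. a \<in> B \<rightarrow>\<^sub>E UNIV \<and> W.lincomb a B = v" if "v \<in> C" for v
    using W.basis_criterion[OF B(1) BC] B(2) that by simp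
  have "bij_betw (\<lambda>a. W.lincomb a B) (B \<rightarrow>\<^sub>E UNIV) C"
  proof (rule bij_betw_imageI)
    have closed: "W.lincomb a B \<in> C" for a
      using W.lincomb_closed[of B a] BC by simp
    show "inj_on (\<lambda>a. W.lincomb a B) (B \<rightarrow>\<^sub>E UNIV)"
    proof (rule inj_onI)
      fix a b assume "a \<in> B \<rightarrow>\<^sub>E UNIV" "b \<in> B \<rightarrow>\<^sub>E UNIV" "W.lincomb a B = W.lincomb b B"
      then show "a = b" using repr[OF closed[of b]] by auto
    qed
    show "(\<lambda>a. W.lincomb a B) ` (B \<rightarrow>\<^sub>E UNIV) = C"
      using closed repr by blast
  qed
  then have "card C = card (B \<rightarrow>\<^sub>E (UNIV :: 'a set))"
    by (simp add: bij_betw_same_card)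
  also have "\<dots> = CARD('a) ^ card B"
    using B(1) by (simp add: card_PiE)
  finally show ?thesis
    using W.dim_basis[OF B] by (simp add: code_dim_def)
qed

lemma one_less_card_field: "1 < CARD('a::{field,finite})"
proof -
  have "card {0, 1 :: 'a} \<le> CARD('a)" by (intro card_mono) auto
  then show ?thesis by simp
qed

text \<open>An injective image has the same cardinality, and powers of a base above 1 determine the
  exponent.\<close>

lemma code_dim_inj_image:
  fixes C :: "'a::{field,finite} vec set" and T :: "'a vec \<Rightarrow> 'a vec"
  assumes "linear_code n C" "linear_code m (T ` C)" "inj_on T C"
  shows "code_dim m (T ` C) = code_dim n C"
  using card_linear_code[OF assms(1)] card_linear_code[OF assms(2)] card_image[OF assms(3)]
    one_less_card_field[where 'a = 'a]
  by simp

section \<open>Minimum distance and locality\<close>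

text \<open>Replaces the infimum by its lower bounds, so that codes of minimum distance \<infinity>
  need no separate treatment.\<close>

lemma le_min_dist_iff:
  "e \<le> min_dist C \<longleftrightarrow> (\<forall>u\<in>C. \<forall>v\<in>C. u \<noteq> v \<longrightarrow> e \<le> enat (hamming_dist u v))"
  by (auto simp: min_dist_def le_Inf_iff)

lemma min_dist_le: "u \<in> C \<Longrightarrow> v \<in> C \<Longrightarrow> u \<noteq> v \<Longrightarrow> min_dist C \<le> enat (hamming_dist u v)"
  using le_min_dist_iff[of "min_dist C" C] by simp

lemma min_dist_attained:
  assumes "min_dist C \<noteq> \<infinity>"
  obtains u v where "u \<in> C" "v \<in> C" "u \<noteq> v" "min_dist C = enat (hamming_dist u v)"
proof -
  let ?D = "{enat (hamming_dist u v) |u v. u \<in> C \<and> v \<in> C \<and> u \<noteq> v}"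
  have "?D \<noteq> {}"
  proof
    assume "?D = {}"
    then show False
      using assms unfolding min_dist_def by (simp only: Inf_empty top_enat_def)
  qed
  then obtain e where "e \<in> ?D" by blast
  \<comment> \<open>In \<open>enat\<close> the infimum of a nonempty set is its least element, hence
    attained.\<close>
  from LeastI[of "\<lambda>e. e \<in> ?D", OF this] have "Inf ?D \<in> ?D"
    unfolding Inf_enat_def using \<open>?D \<noteq> {}\<close> by (simp only: if_False)
  then show thesis
    using that by (auto simp: min_dist_def)
qed

lemma min_dist_pos:
  assumes "linear_code n C"
  shows "0 < min_dist C"
proof -
  have "1 \<le> hamming_dist u v" if uv: "u \<in> C" "v \<in> C" "u \<noteq> v" for u v
  proof -
    have dims: "dim_vec u = n" "dim_vec v = n"
      using linear_code_carrier(2)[OF assms] uv by auto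
    then obtain i where "i < n" "u $ i \<noteq> v $ i" using uv(3) eq_vecI by metis
    then have "{i. i < dim_vec u \<and> u $ i \<noteq> v $ i} \<noteq> {}" using dims by auto
    then show ?thesis by (simp add: hamming_dist_def Suc_le_eq card_gt_0_iff)
  qed
  then have "enat 1 \<le> min_dist C" by (auto simp: le_min_dist_iff)
  then show ?thesis by (rule less_le_trans[rotated]) (simp add: zero_enat_def)
qed

lemma hamming_dist_self [simp]: "hamming_dist u u = 0"
  by (simp add: hamming_dist_def)

text \<open>Passes from \<open>R\<close> to \<open>A = insert i R\<close>; the coordinate
  \<open>i\<close> itself accounts for the bound \<open>r + 1\<close> in place of
  \<open>r\<close>.\<close>

lemma has_locality_iff:
  "has_locality n C r \<longleftrightarrow> (\<forall>i<n. \<exists>A. recovery_set n C i A \<and> card A \<le> r + 1)"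
proof -
  have "(\<exists>R. R \<subseteq> {..<n} - {i} \<and> card R \<le> r \<and> recovery_set n C i (insert i R)) \<longleftrightarrow>
      (\<exists>A. recovery_set n C i A \<and> card A \<le> r + 1)" (is "?L \<longleftrightarrow> ?R") for i
  proof
    assume ?L
    then obtain R where R: "R \<subseteq> {..<n} - {i}" "card R \<le> r" "recovery_set n C i (insert i R)"
      by blast
    then have "card (insert i R) \<le> r + 1"
      using finite_subset[of R "{..<n} - {i}"] by (simp add: card_insert_if)
    then show ?R using R by blast
  next
    assume ?R
    then obtain A where A: "recovery_set n C i A" "card A \<le> r + 1" by blast
    then have "A \<subseteq> {..<n}" "i \<in> A" by (auto simp: recovery_set_def)
    then have "A - {i} \<subseteq> {..<n} - {i}" "card (A - {i}) \<le> r" "insert i (A - {i}) = A"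
      using A(2) finite_subset[of A "{..<n}"] by auto
    then show ?L using A(1) by metis
  qed
  then show ?thesis by (simp add: has_locality_def)
qed

section \<open>Appending a zero coordinate\<close>

definition append_zero :: "'a::zero vec \<Rightarrow> 'a vec" where
  "append_zero c = vec (dim_vec c + 1) (\<lambda>j. if j < dim_vec c then c $ j else 0)"

lemma dim_append_zero [simp]: "dim_vec (append_zero c) = dim_vec c + 1"
  by (simp add: append_zero_def)

lemma append_zero_index [simp]:
  "j < dim_vec c \<Longrightarrow> append_zero c $ j = c $ j" "append_zero c $ dim_vec c = 0"
  by (simp_all add: append_zero_def)

lemma inj_append_zero: "inj append_zero"
proof (rule injI)
  fix u v :: "'a vec"
  assume eq: "append_zero u = append_zero v"
  then have dim: "dim_vec u = dim_vec v" by (metis add_right_cancel dim_append_zero)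
  show "u = v"
    using dim eq by (intro eq_vecI) (metis append_zero_index(1))+
qed

lemma hamming_dist_append_zero:
  "dim_vec u = dim_vec v \<Longrightarrow> hamming_dist (append_zero u) (append_zero v) = hamming_dist u v"
  unfolding hamming_dist_def
  by (rule arg_cong[of _ _ card]) (auto simp: append_zero_def less_Suc_eq)

lemma linear_code_append_zero:
  fixes C :: "'a::{field,finite} vec set"
  assumes "linear_code n C"
  shows "linear_code (n + 1) (append_zero ` C)"
  by (rule linear_code_image[OF assms]) (auto simp: append_zero_def)

lemma min_dist_append_zero:
  assumes "linear_code n C"
  shows "min_dist (append_zero ` C) = min_dist C"
proof -
  have "e \<le> min_dist (append_zero ` C) \<longleftrightarrow> e \<le> min_dist C" for e
    using linear_code_carrier(2)[OF assms]
    by (simp add: le_min_dist_iff hamming_dist_append_zero inj_eq[OF inj_append_zero])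
  \<comment> \<open>The two distances have the same lower bounds, so each bounds the other.\<close>
  from this[of "min_dist C"] this[of "min_dist (append_zero ` C)"] show ?thesis by simp
qed

lemma has_locality_append_zero:
  assumes C: "linear_code n C" and loc: "has_locality n C r"
  shows "has_locality (n + 1) (append_zero ` C) r"
  unfolding has_locality_iff
proof (intro allI impI)
  fix i assume "i < n + 1"
  then consider "i < n" | "i = n" by linarith
  then show "\<exists>A. recovery_set (n + 1) (append_zero ` C) i A \<and> card A \<le> r + 1"
  proof cases
    case 1
    then obtain A where A: "recovery_set n C i A" "card A \<le> r + 1"
      using loc by (auto simp: has_locality_iff)
    have eq: "agree_on B (append_zero u) (append_zero v) \<longleftrightarrow> agree_on B u v"
      if "u \<in> C" "v \<in> C" "B \<subseteq> A" for B u v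
      using that linear_code_carrier(2)[OF C] A(1) by (auto simp: agree_on_def recovery_set_def subset_iff)
    have "recovery_set (n + 1) (append_zero ` C) i A"
      using A(1) eq[OF _ _ subset_refl] eq[of _ _ "A - {i}"]
      by (auto simp: recovery_set_def)
    then show ?thesis using A(2) by blast
  next
    case 2
    \<comment> \<open>The new coordinate is constantly zero, so it is recovered from the empty
      set.\<close>
    have "recovery_set (n + 1) (append_zero ` C) i {n}"
      using 2 linear_code_carrier(2)[OF C]
      by (auto simp: recovery_set_def agree_on_def append_zero_def)
    then show ?thesis by force
  qed
qed

section \<open>Shortening and puncturing\<close>

text \<open>If \<sigma> enumerates the complement of \<open>A\<close>, this is puncturing at
  \<open>A\<close> with the surviving coordinates renumbered.\<close>

definition select_coords :: "nat \<Rightarrow> (nat \<Rightarrow> nat) \<Rightarrow> 'a vec \<Rightarrow> 'a vec" where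
  "select_coords m \<sigma> c = vec m (\<lambda>j. c $ \<sigma> j)"

text \<open>The length is unchanged here: the vanishing coordinates are deleted afterwards by
  \<open>select_coords\<close>.\<close>

definition shorten :: "nat set \<Rightarrow> 'a::zero vec set \<Rightarrow> 'a vec set" where
  "shorten Z C = {c \<in> C. \<forall>i\<in>Z. c $ i = 0}"

lemma select_coords_index [simp]:
  "dim_vec (select_coords m \<sigma> c) = m" "j < m \<Longrightarrow> select_coords m \<sigma> c $ j = c $ \<sigma> j"
  by (simp_all add: select_coords_def)

lemma linear_code_shorten:
  fixes C :: "'a::{field,finite} vec set"
  assumes "linear_code n C" "Z \<subseteq> {..<n}"
  shows "linear_code n (shorten Z C)"
proof -
  have "i < dim_vec c" if "c \<in> C" "i \<in> Z" for c i
    using that assms linear_code_carrier(2)[OF assms(1)] by auto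
  then show ?thesis
    using assms linear_codeD[OF assms(1)] unfolding linear_code_iff shorten_def by auto
qed

lemma linear_code_select_coords:
  fixes C :: "'a::{field,finite} vec set"
  assumes "linear_code n C" "\<sigma> ` {..<m} \<subseteq> {..<n}"
  shows "linear_code m (select_coords m \<sigma> ` C)"
proof (rule linear_code_image[OF assms(1)])
  have [simp]: "\<sigma> j < n" if "j < m" for j using that assms(2) by auto
  show "select_coords m \<sigma> (u + v) = select_coords m \<sigma> u + select_coords m \<sigma> v"
    if "u \<in> carrier_vec n" "v \<in> carrier_vec n" for u v :: "'a vec"
    using that by (intro eq_vecI) auto
  show "select_coords m \<sigma> (a \<cdot>\<^sub>v u) = a \<cdot>\<^sub>v select_coords m \<sigma> u"
    if "u \<in> carrier_vec n" for a and u :: "'a vec"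
    using that by (intro eq_vecI) auto
qed (simp add: select_coords_def)

text \<open>The codewords with prescribed coordinates in \<open>Z\<close> form a translate of a subset of the
  shortened code, and there are at most \<open>q ^ card Z\<close> ways to prescribe these coordinates.\<close>

lemma code_dim_shorten:
  fixes C :: "'a::{field,finite} vec set"
  assumes C: "linear_code n C" and Z: "Z \<subseteq> {..<n}"
  shows "code_dim n C \<le> card Z + code_dim n (shorten Z C)"
proof -
  let ?q = "CARD('a)"
  let ?S = "shorten Z C"
  let ?f = "\<lambda>c. restrict (vec_index c) Z"
  have finC: "finite C" by (rule finite_linear_code[OF C])
  then have finS: "finite ?S" by (simp add: shorten_def)
  have finZ: "finite Z" using Z by (rule finite_subset) simp
  have fibre: "card {c \<in> C. ?f c = y} \<le> card ?S" if y: "y \<in> ?f ` C" for y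
  proof -
    obtain w where w: "w \<in> C" "y = ?f w" using y by auto
    show ?thesis
    proof (rule card_inj_on_le)
      \<comment> \<open>Subtracting one fixed word \<open>w\<close> of the fibre moves the whole
        fibre into the shortened code.\<close>
      show "inj_on (\<lambda>c. c - w) {c \<in> C. ?f c = y}"
      proof (rule inj_onI)
        fix u v assume uv: "u \<in> {c \<in> C. ?f c = y}" "v \<in> {c \<in> C. ?f c = y}" "u - w = v - w"
        have dims: "dim_vec u = n" "dim_vec v = n" "dim_vec w = n"
          using uv(1,2) w(1) linear_code_carrier(2)[OF C] by auto
        show "u = v"
        proof (rule eq_vecI)
          fix i assume i: "i < dim_vec v"
          then have "(u - w) $ i = (v - w) $ i" by (simp add: uv(3))
          then show "u $ i = v $ i" using i dims by simp
        qed (simp add: dims)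
      qed
      have "c - w \<in> ?S" if c: "c \<in> C" "?f c = ?f w" for c
      proof -
        have "c $ i = w $ i" if "i \<in> Z" for i
          using fun_cong[OF c(2), of i] that by simp
        moreover have "dim_vec w = n" by (rule linear_code_carrier(2)[OF C w(1)])
        ultimately show ?thesis
          using linear_code_diff[OF C c(1) w(1)] Z by (auto simp: shorten_def subset_iff)
      qed
      then show "(\<lambda>c. c - w) ` {c \<in> C. ?f c = y} \<subseteq> ?S" using w(2) by auto
    qed (rule finS)
  qed
  have "card C = card (\<Union>y\<in>?f ` C. {c \<in> C. ?f c = y})"
    by (rule arg_cong[of _ _ card]) auto
  also have "\<dots> \<le> (\<Sum>y\<in>?f ` C. card {c \<in> C. ?f c = y})"
    using finC by (intro card_UN_le) simp
  also have "\<dots> \<le> card (?f ` C) * card ?S"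
    using sum_bounded_above[of "?f ` C", OF fibre] by simp
  also have "card (?f ` C) \<le> card (Z \<rightarrow>\<^sub>E (UNIV :: 'a set))"
    using finZ by (intro card_mono finite_PiE) auto
  also have "card (Z \<rightarrow>\<^sub>E (UNIV :: 'a set)) = ?q ^ card Z"
    using finZ by (simp add: card_PiE)
  finally have "card C \<le> ?q ^ card Z * card ?S" by simp
  then have "?q ^ code_dim n C \<le> ?q ^ (card Z + code_dim n ?S)"
    using card_linear_code[OF C] card_linear_code[OF linear_code_shorten[OF C Z]]
    by (simp add: power_add)
  then show ?thesis
    by (rule power_le_imp_le_exp[OF one_less_card_field])
qed

text \<open>The differing positions split into those outside \<open>A\<close>, which \<sigma>
  matches with positions of the selected words, and those in \<open>A\<close>.\<close>

lemma hamming_dist_select_coords: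
  assumes \<sigma>: "bij_betw \<sigma> {..<m} ({..<n} - A)" and A: "A \<subseteq> {..<n}" and u: "dim_vec u = n"
  shows "hamming_dist u v =
    hamming_dist (select_coords m \<sigma> u) (select_coords m \<sigma> v) + card {i \<in> A. u $ i \<noteq> v $ i}"
proof -
  let ?D = "{j. j < m \<and> u $ \<sigma> j \<noteq> v $ \<sigma> j}"
  have inj: "inj_on \<sigma> {..<m}" and img: "\<sigma> ` {..<m} = {..<n} - A"
    using \<sigma> by (auto simp: bij_betw_def)
  have "{i. i < dim_vec u \<and> u $ i \<noteq> v $ i} = \<sigma> ` ?D \<union> {i \<in> A. u $ i \<noteq> v $ i}" (is "?L = ?R")
  proof
    show "?L \<subseteq> ?R"
    proof
      fix i assume i: "i \<in> ?L"
      show "i \<in> ?R"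
      proof (cases "i \<in> A")
        case False
        then have "i \<in> \<sigma> ` {..<m}" using i img u by simp
        then show ?thesis using i by auto
      qed (use i in auto)
    qed
    show "?R \<subseteq> ?L" using img A u by auto
  qed
  moreover have "card (\<sigma> ` ?D \<union> {i \<in> A. u $ i \<noteq> v $ i}) =
      card (\<sigma> ` ?D) + card {i \<in> A. u $ i \<noteq> v $ i}"
    using finite_subset[OF A] img by (intro card_Un_disjoint) auto
  moreover have "card (\<sigma> ` ?D) = card ?D"
    using inj by (intro card_image) (auto intro: inj_on_subset)
  moreover have "?D = {j. j < m \<and> select_coords m \<sigma> u $ j \<noteq> select_coords m \<sigma> v $ j}" by auto
  ultimately show ?thesis by (simp add: hamming_dist_def)
qed

text \<open>Deleting \<open>A\<close> removes from \<open>R\<close> only positions in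
  \<open>Z\<close>, where all words of the shortened code are zero and hence agree. The rest of
  \<open>R\<close> is pulled back along \<sigma>.\<close>

lemma recovery_set_select_coords:
  assumes \<sigma>: "bij_betw \<sigma> {..<m} ({..<n} - A)" and j: "j < m"
    and R: "recovery_set n C (\<sigma> j) R" and RZ: "R \<inter> A \<subseteq> Z"
  shows "recovery_set m (select_coords m \<sigma> ` shorten Z C) j {l. l < m \<and> \<sigma> l \<in> R}"
    (is "recovery_set _ _ _ ?R")
proof -
  have img: "\<sigma> ` {..<m} = {..<n} - A" and inj: "inj_on \<sigma> {..<m}"
    using \<sigma> by (auto simp: bij_betw_def)
  have agree: "agree_on {l. l < m \<and> \<sigma> l \<in> B} (select_coords m \<sigma> u) (select_coords m \<sigma> v) \<longleftrightarrow>
      agree_on B u v" if "u \<in> shorten Z C" "v \<in> shorten Z C" "B \<subseteq> R" for B u v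
  proof
    assume L: "agree_on {l. l < m \<and> \<sigma> l \<in> B} (select_coords m \<sigma> u) (select_coords m \<sigma> v)"
    show "agree_on B u v"
      unfolding agree_on_def
    proof
      fix i assume i: "i \<in> B"
      show "u $ i = v $ i"
      proof (cases "i \<in> A")
        case True
        then show ?thesis using that i RZ by (auto simp: shorten_def)
      next
        case False
        then have "i \<in> \<sigma> ` {..<m}" using i R that(3) by (auto simp: img recovery_set_def)
        then show ?thesis using L i by (auto simp: agree_on_def)
      qed
    qed
  qed (auto simp: agree_on_def)
  \<comment> \<open>By injectivity of \<sigma>, removing \<open>j\<close> from the preimage removes
    exactly \<sigma> \<open>j\<close> from \<open>R\<close>, so \<open>agree\<close> applies to both
    sides.\<close>
  have "?R - {j} = {l. l < m \<and> \<sigma> l \<in> R - {\<sigma> j}}"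
    using inj j by (auto simp: inj_on_eq_iff)
  then have "agree_on ?R (select_coords m \<sigma> u) (select_coords m \<sigma> v) \<longleftrightarrow>
      agree_on (?R - {j}) (select_coords m \<sigma> u) (select_coords m \<sigma> v)"
    if "u \<in> shorten Z C" "v \<in> shorten Z C" for u v
    using agree[OF that, of R] agree[OF that, of "R - {\<sigma> j}"] R that
    by (auto simp: recovery_set_def shorten_def)
  then show ?thesis
    using j R by (auto simp: recovery_set_def)
qed

text \<open>The condition \<open>R \<inter> A \<subseteq> Z\<close> is automatic for pure shortening
  (\<open>Z = A\<close>), and holds for any \<open>Z\<close> if \<open>R\<close> is disjoint from
  \<open>A\<close>.\<close>

lemma has_locality_select_coords:
  assumes \<sigma>: "bij_betw \<sigma> {..<m} ({..<n} - A)"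
    and R: "\<And>i. i < n \<Longrightarrow> i \<notin> A \<Longrightarrow> \<exists>R. recovery_set n C i R \<and> card R \<le> r + 1 \<and> R \<inter> A \<subseteq> Z"
  shows "has_locality m (select_coords m \<sigma> ` shorten Z C) r"
  unfolding has_locality_iff
proof (intro allI impI)
  fix j assume j: "j < m"
  then have "\<sigma> j \<in> {..<n} - A" using \<sigma> by (auto simp: bij_betw_def)
  then obtain R where R: "recovery_set n C (\<sigma> j) R" "card R \<le> r + 1" "R \<inter> A \<subseteq> Z"
    using R by blast
  have "finite R" using R(1) finite_subset by (auto simp: recovery_set_def)
  moreover have "inj_on \<sigma> {l. l < m \<and> \<sigma> l \<in> R}"
    using \<sigma> by (auto simp: bij_betw_def intro: inj_on_subset)
  ultimately have "card {l. l < m \<and> \<sigma> l \<in> R} \<le> card R"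
    by (intro card_inj_on_le) auto
  then show "\<exists>B. recovery_set m (select_coords m \<sigma> ` shorten Z C) j B \<and> card B \<le> r + 1"
    using recovery_set_select_coords[OF \<sigma> j R(1,3)] R(2) le_trans by blast
qed

lemma ex_bij_betw_diff:
  assumes "A \<subseteq> {..<n}"
  obtains \<sigma> where "bij_betw \<sigma> {..<n - card A} ({..<n} - A)"
proof -
  have "card ({..<n} - A) = n - card A"
    using assms finite_subset[OF assms] by (simp add: card_Diff_subset)
  then show thesis
    using finite_same_card_bij[of "{..<n - card A}" "{..<n} - A"] that by auto
qed

text \<open>\<open>Z\<close> is the set of shortened and \<open>A - Z\<close> the set of punctured coordinates.\<close>

lemma shorten_puncture:
  fixes C :: "'a::{field,finite} vec set"
  assumes C: "linear_code n C" and A: "A \<subseteq> {..<n}" and Z: "Z \<subseteq> A"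
    and \<sigma>: "bij_betw \<sigma> {..<m} ({..<n} - A)" and d: "enat (card (A - Z)) < min_dist C"
  shows "linear_code m (select_coords m \<sigma> ` shorten Z C)"
    and "code_dim n C \<le> card Z + code_dim m (select_coords m \<sigma> ` shorten Z C)"
    and "min_dist C - enat (card (A - Z)) \<le> min_dist (select_coords m \<sigma> ` shorten Z C)"
proof -
  let ?S = "shorten Z C"
  let ?C' = "select_coords m \<sigma> ` ?S"
  have Zn: "Z \<subseteq> {..<n}" using A Z by auto
  have S: "linear_code n ?S" by (rule linear_code_shorten[OF C Zn])
  show C': "linear_code m ?C'"
    using \<sigma> by (intro linear_code_select_coords[OF S]) (auto simp: bij_betw_def)
  have finA: "finite A" using A by (rule finite_subset) simp
  have dist: "hamming_dist u v \<le>
      hamming_dist (select_coords m \<sigma> u) (select_coords m \<sigma> v) + card (A - Z)"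
    if "u \<in> ?S" "v \<in> ?S" for u v
  proof -
    \<comment> \<open>Both words vanish on \<open>Z\<close>, so only punctured coordinates can cost
      distance.\<close>
    have "{i \<in> A. u $ i \<noteq> v $ i} \<subseteq> A - Z" using that by (auto simp: shorten_def)
    then have "card {i \<in> A. u $ i \<noteq> v $ i} \<le> card (A - Z)"
      using finA by (intro card_mono) auto
    then show ?thesis
      using hamming_dist_select_coords[OF \<sigma> A linear_code_carrier(2)[OF S that(1)], of v] by simp
  qed
  have SC: "?S \<subseteq> C" by (auto simp: shorten_def)
  \<comment> \<open>Distinct words with the same image would have distance at most
    \<open>card (A - Z)\<close>, below the minimum distance.\<close>
  have "inj_on (select_coords m \<sigma>) ?S"
  proof (rule inj_onI, rule ccontr)
    fix u v assume uv: "u \<in> ?S" "v \<in> ?S" "select_coords m \<sigma> u = select_coords m \<sigma> v" "u \<noteq> v"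
    have "hamming_dist u v \<le> card (A - Z)"
      using dist[OF uv(1,2)] uv(3) by simp
    moreover have "enat (card (A - Z)) < enat (hamming_dist u v)"
      using d min_dist_le[OF subsetD[OF SC uv(1)] subsetD[OF SC uv(2)] uv(4)]
      by (rule less_le_trans)
    ultimately show False by simp
  qed
  from code_dim_inj_image[OF S C' this]
  show "code_dim n C \<le> card Z + code_dim m ?C'"
    using code_dim_shorten[OF C Zn] by simp
  show "min_dist C - enat (card (A - Z)) \<le> min_dist ?C'"
    unfolding le_min_dist_iff
  proof (clarify)
    fix u v assume uv: "u \<in> ?S" "v \<in> ?S" "select_coords m \<sigma> u \<noteq> select_coords m \<sigma> v"
    then have "min_dist C \<le> enat (hamming_dist u v)" using SC by (intro min_dist_le) auto
    also have "\<dots> \<le> enat (hamming_dist (select_coords m \<sigma> u) (select_coords m \<sigma> v) + card (A - Z))"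
      using dist[OF uv(1,2)] by simp
    finally show "min_dist C - enat (card (A - Z)) \<le>
        enat (hamming_dist (select_coords m \<sigma> u) (select_coords m \<sigma> v))"
      \<comment> \<open>An infinite \<open>min_dist C\<close> contradicts the finite bound just
        derived.\<close>
      by (cases "min_dist C") auto
  qed
qed

section \<open>The three constructions\<close>

lemma lengthened_code:
  fixes C :: "'a::{field,finite} vec set"
  assumes C: "linear_code n C" and loc: "has_locality n C r"
  shows "\<exists>C' :: 'a vec set. linear_code (n + 1) C' \<and> code_dim (n + 1) C' = code_dim n C \<and>
    min_dist C' = min_dist C \<and> has_locality (n + 1) C' r"
  using linear_code_append_zero[OF C] min_dist_append_zero[OF C] has_locality_append_zero[OF C loc]
    code_dim_inj_image[OF C linear_code_append_zero[OF C] inj_on_subset[OF inj_append_zero subset_UNIV]]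
  by blast

text \<open>Shortening never decreases the distance; keeping it exact requires a minimum weight word
  to survive. The alternative covers \<open>d = n\<close>, which no code of length
  \<open>n - 1\<close> can attain.\<close>

lemma shortened_code:
  fixes C :: "'a::{field,finite} vec set"
  assumes C: "linear_code n C" and loc: "has_locality n C r" and n: "1 \<le> n"
  shows "\<exists>C' :: 'a vec set. linear_code (n - 1) C' \<and> code_dim n C \<le> 1 + code_dim (n - 1) C' \<and>
    (min_dist C' = min_dist C \<or> min_dist C = enat n \<and> C' = {0\<^sub>v (n - 1)}) \<and>
    has_locality (n - 1) C' r"
proof -
  \<comment> \<open>Reduces the claim to choosing \<open>i\<close> and bounding the distance from
    above, or showing that only zero is left. With \<open>A = Z = {i}\<close> nothing is punctured,
    so the lower bound loses nothing.\<close>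
  have short: "\<exists>C' :: 'a vec set. linear_code (n - 1) C' \<and> code_dim n C \<le> 1 + code_dim (n - 1) C' \<and>
      (min_dist C' = min_dist C \<or> min_dist C = enat n \<and> C' = {0\<^sub>v (n - 1)}) \<and>
      has_locality (n - 1) C' r"
    if i: "i < n" and dist: "\<And>\<sigma>. bij_betw \<sigma> {..<n - 1} ({..<n} - {i}) \<Longrightarrow>
        min_dist (select_coords (n - 1) \<sigma> ` shorten {i} C) \<le> min_dist C \<or>
        min_dist C = enat n \<and> shorten {i} C = {0\<^sub>v n}" for i
  proof -
    obtain \<sigma> where \<sigma>: "bij_betw \<sigma> {..<n - 1} ({..<n} - {i})"
      using ex_bij_betw_diff[of "{i}" n] i by auto
    let ?C' = "select_coords (n - 1) \<sigma> ` shorten {i} C"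
    have props: "linear_code (n - 1) ?C'" "code_dim n C \<le> 1 + code_dim (n - 1) ?C'"
      "min_dist C \<le> min_dist ?C'"
      using shorten_puncture[OF C _ subset_refl \<sigma>] i min_dist_pos[OF C]
      by (simp_all flip: zero_enat_def)
    have "?C' = {0\<^sub>v (n - 1)}" if "shorten {i} C = {0\<^sub>v n}"
      using linear_codeD(2)[OF props(1)] that by auto
    then have "min_dist ?C' = min_dist C \<or> min_dist C = enat n \<and> ?C' = {0\<^sub>v (n - 1)}"
      using dist[OF \<sigma>] props(3) by auto
    moreover have "has_locality (n - 1) ?C' r"
      using loc by (intro has_locality_select_coords[OF \<sigma>]) (auto simp: has_locality_iff)
    ultimately show ?thesis using props(1,2) by blast
  qed
  show ?thesis
  proof (cases "min_dist C = \<infinity>")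
    case True
    \<comment> \<open>The upper bound \<infinity> is trivial, so any coordinate will do.\<close>
    with n show ?thesis by (intro short[of 0] disjI1) simp_all
  next
    case False
    then obtain u v where uv: "u \<in> C" "v \<in> C" "u \<noteq> v" "min_dist C = enat (hamming_dist u v)"
      by (rule min_dist_attained)
    have dims: "dim_vec u = n" "dim_vec v = n"
      using linear_code_carrier(2)[OF C] uv by auto
    show ?thesis
    \<comment> \<open>The word \<open>u - v\<close> has minimum weight and vanishes exactly where
      \<open>u\<close> and \<open>v\<close> agree.\<close>
    proof (cases "\<exists>i<n. u $ i = v $ i")
      case True
      then obtain i where i: "i < n" "u $ i = v $ i" by blast
      show ?thesis
      proof (rule short[OF i(1)], rule disjI1)
        fix \<sigma> assume \<sigma>: "bij_betw \<sigma> {..<n - 1} ({..<n} - {i})"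
        let ?z = "0\<^sub>v n :: 'a vec"
        have mem: "u - v \<in> shorten {i} C" "?z \<in> shorten {i} C"
          using linear_code_diff[OF C uv(1,2)] linear_codeD(2)[OF C] i dims
          by (auto simp: shorten_def)
        have eq: "hamming_dist (u - v) ?z = hamming_dist u v"
          unfolding hamming_dist_def using dims by (intro arg_cong[of _ _ card]) auto
        \<comment> \<open>No difference is lost at \<open>i\<close>, so the images of
          \<open>u - v\<close> and zero still have the minimum distance of \<open>C\<close>.\<close>
        have "{l \<in> {i}. (u - v) $ l \<noteq> ?z $ l} = {}" using i dims by auto
        then have sel: "hamming_dist (select_coords (n - 1) \<sigma> (u - v)) (select_coords (n - 1) \<sigma> ?z)
            = hamming_dist u v"
          using hamming_dist_select_coords[OF \<sigma>, of "u - v" ?z] i(1) dims eq by simp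
        have "0 < hamming_dist u v"
          using min_dist_pos[OF C] uv(4) by (simp add: zero_enat_def)
        then have ne: "select_coords (n - 1) \<sigma> (u - v) \<noteq> select_coords (n - 1) \<sigma> ?z"
          unfolding sel[symmetric] by auto
        show "min_dist (select_coords (n - 1) \<sigma> ` shorten {i} C) \<le> min_dist C"
          unfolding uv(4) sel[symmetric] by (intro min_dist_le imageI mem ne)
      qed
    next
      case False
      then have "{i. i < dim_vec u \<and> u $ i \<noteq> v $ i} = {..<n}" using dims by auto
      then have d: "min_dist C = enat n" using uv(4) by (simp add: hamming_dist_def)
      \<comment> \<open>A word vanishing at coordinate 0 has weight at most \<open>n - 1\<close>,
        below the minimum distance \<open>n\<close>.\<close>
      have "c = 0\<^sub>v n" if c: "c \<in> C" "c $ 0 = 0" for c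
      proof (rule ccontr)
        assume "c \<noteq> 0\<^sub>v n"
        then have "n \<le> hamming_dist c (0\<^sub>v n)"
          using min_dist_le[OF c(1) linear_codeD(2)[OF C]] d by simp
        moreover have "{i. i < dim_vec c \<and> c $ i \<noteq> 0\<^sub>v n $ i} \<subseteq> {1..<n}"
        proof
          fix i assume i: "i \<in> {i. i < dim_vec c \<and> c $ i \<noteq> 0\<^sub>v n $ i}"
          then have "i < n" "c $ i \<noteq> 0" using linear_code_carrier(2)[OF C c(1)] by auto
          moreover from this have "i \<noteq> 0" using c(2) by metis
          ultimately show "i \<in> {1..<n}" by simp
        qed
        then have "card {i. i < dim_vec c \<and> c $ i \<noteq> 0\<^sub>v n $ i} \<le> card {1..<n}"
          by (rule card_mono[rotated]) simp
        then have "hamming_dist c (0\<^sub>v n) \<le> n - 1"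
          by (simp add: hamming_dist_def)
        ultimately show False using n by simp
      qed
      then have "shorten {0} C \<subseteq> {0\<^sub>v n}" by (auto simp only: shorten_def)
      moreover have "0\<^sub>v n \<in> shorten {0} C"
        using linear_codeD(2)[OF C] n by (simp add: shorten_def)
      ultimately have "shorten {0} C = {0\<^sub>v n}" by blast
      with d have "min_dist C = enat n \<and> shorten {0} C = {0\<^sub>v n}" by blast
      with n show ?thesis by (intro short[of 0] disjI2) simp
    qed
  qed
qed

lemma code_without_recovery_set:
  fixes C :: "'a::{field,finite} vec set"
  assumes C: "linear_code n C" and P: "disjoint_recovery_sets n C r P" and A: "A \<in> P"
    and s: "s \<le> card A" "enat s < min_dist C"
  shows "\<exists>C' :: 'a vec set. linear_code (n - card A) C' \<and>
    code_dim n C \<le> card A - s + code_dim (n - card A) C' \<and>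
    min_dist C - enat s \<le> min_dist C' \<and> has_locality (n - card A) C' r"
proof -
  have part: "partition_on {..<n} P"
    and rec: "\<And>B i. B \<in> P \<Longrightarrow> i \<in> B \<Longrightarrow> card B \<le> r + 1 \<and> recovery_set n C i B"
    using P by (auto simp: disjoint_recovery_sets_def)
  have An: "A \<subseteq> {..<n}" using part A by (auto simp: partition_on_def)
  then have finA: "finite A" by (rule finite_subset) simp
  \<comment> \<open>This size leaves \<open>s\<close> coordinates of \<open>A\<close> to puncture:
    each shortened one may cost a dimension, each punctured one a unit of distance.\<close>
  obtain Z where Z: "Z \<subseteq> A" "card Z = card A - s"
    using obtain_subset_with_card_n[of "card A - s" A] by auto
  then have AZ: "card (A - Z) = s"
    using s(1) finA finite_subset[OF Z(1)] by (simp add: card_Diff_subset)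
  obtain \<sigma> where \<sigma>: "bij_betw \<sigma> {..<n - card A} ({..<n} - A)"
    by (rule ex_bij_betw_diff[OF An])
  have "has_locality (n - card A) (select_coords (n - card A) \<sigma> ` shorten Z C) r"
  proof (rule has_locality_select_coords[OF \<sigma>])
    fix i assume i: "i < n" "i \<notin> A"
    then obtain B where B: "B \<in> P" "i \<in> B"
      using part by (auto simp: partition_on_def)
    \<comment> \<open>Distinct blocks are disjoint, so the block of a surviving coordinate is left
      intact.\<close>
    then have "B \<inter> A = {}"
      using part A i(2) disjointD[of P B A] by (auto simp: partition_on_def)
    then show "\<exists>R. recovery_set n C i R \<and> card R \<le> r + 1 \<and> R \<inter> A \<subseteq> Z"
      using rec[OF B] by blast
  qed
  then show ?thesis
    using shorten_puncture[OF C An Z(1) \<sigma>] s(2) unfolding AZ Z(2) by blast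
qed

text \<open>The bound \<open>enat s < d\<close> matters: for the code of all words
  \<open>(a, a)\<close> and \<open>s = t = 2\<close>, the third claim would ask for dimension 1 in
  length 0. Dimensions are compared in \<open>int\<close> because truncation in
  \<open>k - t + s\<close> would change the claim when \<open>k < t\<close>.\<close>

theorem lemma3p4:
  fixes C :: "'a::{field,finite} vec set"
    and n k r :: nat
    and d :: enat
  assumes "linear_code n C"
    and "code_dim n C = k"
    and "min_dist C = d"
    and "has_locality n C r"
  shows
    "(\<exists>C' :: 'a vec set. linear_code (n + 1) C' \<and> code_dim (n + 1) C' = k \<and>
        min_dist C' = d \<and> has_locality (n + 1) C' r)
     \<and>
     (1 \<le> n \<longrightarrow>
      (\<exists>C' :: 'a vec set. linear_code (n - 1) C' \<and> int k - 1 \<le> int (code_dim (n - 1) C') \<and>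
        (min_dist C' = d \<or> d = enat n \<and> C' = {0\<^sub>v (n - 1)}) \<and> has_locality (n - 1) C' r))
     \<and>
     (\<forall>P A t s. disjoint_recovery_sets n C r P \<and> A \<in> P \<and> card A = t \<and> s \<le> t \<and> enat s < d \<longrightarrow>
      (\<exists>C' :: 'a vec set. linear_code (n - t) C' \<and>
        int k - int t + int s \<le> int (code_dim (n - t) C') \<and>
        d - enat s \<le> min_dist C' \<and> has_locality (n - t) C' r))"
proof (intro conjI impI allI)
  show "\<exists>C' :: 'a vec set. linear_code (n + 1) C' \<and> code_dim (n + 1) C' = k \<and>
      min_dist C' = d \<and> has_locality (n + 1) C' r"
    using lengthened_code[OF assms(1,4)] assms(2,3) by simp
next
  assume "1 \<le> n"
  from shortened_code[OF assms(1,4) this] obtain C' :: "'a vec set"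
    where C': "linear_code (n - 1) C'" "code_dim n C \<le> 1 + code_dim (n - 1) C'"
      "min_dist C' = min_dist C \<or> min_dist C = enat n \<and> C' = {0\<^sub>v (n - 1)}"
      "has_locality (n - 1) C' r"
    by blast
  then have "int k - 1 \<le> int (code_dim (n - 1) C')" using assms(2) by linarith
  then show "\<exists>C' :: 'a vec set. linear_code (n - 1) C' \<and> int k - 1 \<le> int (code_dim (n - 1) C') \<and>
      (min_dist C' = d \<or> d = enat n \<and> C' = {0\<^sub>v (n - 1)}) \<and> has_locality (n - 1) C' r"
    using C' assms(3) by blast
next
  fix P A t s
  assume asm: "disjoint_recovery_sets n C r P \<and> A \<in> P \<and> card A = t \<and> s \<le> t \<and> enat s < d"
  then obtain C' :: "'a vec set"
    where C': "linear_code (n - t) C'" "code_dim n C \<le> t - s + code_dim (n - t) C'"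
      "min_dist C - enat s \<le> min_dist C'" "has_locality (n - t) C' r"
    using code_without_recovery_set[OF assms(1), of r P A s] assms(3) by blast
  \<comment> \<open>Here \<open>s \<le> t\<close> makes the natural number \<open>t - s\<close> a
    true difference.\<close>
  then have "int k - int t + int s \<le> int (code_dim (n - t) C')" using assms(2) asm by linarith
  then show "\<exists>C' :: 'a vec set. linear_code (n - t) C' \<and>
      int k - int t + int s \<le> int (code_dim (n - t) C') \<and>
      d - enat s \<le> min_dist C' \<and> has_locality (n - t) C' r"
    using C' assms(3) by blast
qed

end
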